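(* Let $G$ be an uncountable abelian group (regarded as a discrete group, with character group $\widehat G=\operatorname{Hom}(G,\mathbb T)$). Then there is a family of group topologies $\tau_\aleph$ on $G$, indexed by the cardinals $\aleph$ with $\aleph_0\le\aleph\le\operatorname{card}(G)$, such that: (i) for each cardinal $\aleph$ with $\aleph_0\le\aleph\le\operatorname{card}(G)$, the topology $\tau_\aleph$ is a locally quasiconvex group topology on $G$ with $(G,\tau_\aleph)\,\widehat{\phantom{x}}=\widehat G$; (ii) for all cardinals $\aleph<\aleph'$ with $\aleph_0\le\aleph<\aleph'\le\operatorname{card}(G)$ one has $\tau_\aleph\subsetneq\tau_{\aleph'}$.
   Context: $\mathbb T=\mathbb R/\mathbb Z$. For a topological abelian group $(G,\tau)$, a character is a continuous homomorphism $\chi\colon G\to\mathbb T$, and $(G,\tau)\,\widehat{\phantom{x}}$ denotes the group of all characters of $(G,\tau)$ under the pointwise operation. The equality $(G,\tau_\aleph)\,\widehat{\phantom{x}}=\widehat G$ is equality of these character groups, i.e. every homomorphism $G\to\mathbb T$ is $\tau_\aleph$-continuous. Let $\mathbb T_+\subseteq\mathbb T$ be the image of $[-\frac14,\frac14]$. A subset $A$ of a topological abelian group $(G,\tau)$ is quasiconvex if for every $g\in G\setminus A$ there is a character $\chi$ of $(G,\tau)$ with $\chi(A)\subseteq\mathbb T_+$ and $\chi(g)\notin\mathbb T_+$; the group topology $\tau$ is locally quasiconvex if the identity has a neighbourhood basis consisting of quasiconvex sets. *)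

theory Defs
  imports "HOL-Analysis.Analysis"
begin

unbundle cardinal_syntax

no_notation (input) elt_set_eq (infix \<open>=o\<close> 50)

text \<open>The circle group is the quotient of the reals by the integers, with the quotient topology.\<close>

definition circle_rel :: "real \<Rightarrow> real \<Rightarrow> bool" where
  "circle_rel x y \<longleftrightarrow> x - y \<in> \<int>"

quotient_type circle = real / circle_rel
  morphisms rep_circle to_circle
proof (rule equivpI)
  show "reflp circle_rel"
    by (simp add: reflp_def circle_rel_def)
  show "symp circle_rel"
    unfolding symp_def circle_rel_def by (metis Ints_minus minus_diff_eq)
  show "transp circle_rel"
    unfolding transp_def circle_rel_def by (metis Ints_add diff_add_cancel add_diff_eq)
qed

instantiation circle :: ab_group_add
begin

lift_definition zero_circle :: circle is 0 .

lift_definition plus_circle :: "circle \<Rightarrow> circle \<Rightarrow> circle" is "(+)"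
  unfolding circle_rel_def by (metis Ints_add add_diff_add)

lift_definition uminus_circle :: "circle \<Rightarrow> circle" is uminus
  unfolding circle_rel_def by (metis Ints_minus minus_diff_minus)

lift_definition minus_circle :: "circle \<Rightarrow> circle \<Rightarrow> circle" is "(-)"
  unfolding circle_rel_def by (metis Ints_diff diff_diff_eq2 add_diff_eq diff_add_eq diff_diff_add add.commute)

instance
  by standard (transfer; simp add: circle_rel_def algebra_simps)+

end

instantiation circle :: topological_space
begin

definition open_circle :: "circle set \<Rightarrow> bool" where
  "open_circle U \<longleftrightarrow> open (to_circle -` U)"

instance
  by standard (auto simp: open_circle_def vimage_Union)

end

definition circle_plus :: "circle set" where
  "circle_plus = to_circle ` {- (1 / 4) .. 1 / 4}"

text \<open>
  Topologies are values of type \<^typ>\<open>'a topology\<close> rather than type class instances,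
  since several of them live on the same group.
\<close>

definition group_topology :: "'a::ab_group_add topology \<Rightarrow> bool" where
  "group_topology \<tau> \<longleftrightarrow>
     topspace \<tau> = UNIV \<and>
     continuous_map (prod_topology \<tau> \<tau>) \<tau> (\<lambda>(x, y). x + y) \<and>
     continuous_map \<tau> \<tau> uminus"

text \<open>
  The group operation on characters is pointwise addition whatever the topology, so
  two character groups of the same group coincide iff their underlying sets do.
\<close>

definition characters :: "'a::ab_group_add topology \<Rightarrow> ('a \<Rightarrow> circle) set" where
  "characters \<tau> = {\<phi>. Modules.additive \<phi> \<and> continuous_map \<tau> euclidean \<phi>}"

definition quasiconvex :: "'a::ab_group_add topology \<Rightarrow> 'a set \<Rightarrow> bool" where
  "quasiconvex \<tau> A \<longleftrightarrow>
     (\<forall>g. g \<notin> A \<longrightarrow> (\<exists>\<phi>\<in>characters \<tau>. \<phi> ` A \<subseteq> circle_plus \<and> \<phi> g \<notin> circle_plus))"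

definition locally_quasiconvex :: "'a::ab_group_add topology \<Rightarrow> bool" where
  "locally_quasiconvex \<tau> \<longleftrightarrow> neighbourhood_base_at 0 (quasiconvex \<tau>) \<tau>"

text \<open>
  Cardinals are represented by cardinal orders, which are unique only up to order
  isomorphism \<open>=o\<close>. Every cardinal not exceeding that of the type \<^typ>\<open>'a\<close> is
  represented by a relation on \<^typ>\<open>'a\<close> itself.
\<close>

definition index_cardinal :: "'a rel \<Rightarrow> bool" where
  "index_cardinal \<kappa> \<longleftrightarrow> Card_order \<kappa> \<and> natLeq \<le>o \<kappa> \<and> \<kappa> \<le>o |UNIV :: 'a set|"

end

theory Submission
  imports Defs
begin

text \<open>
  A neighbourhood base at \<open>0\<close> for \<open>\<tau> \<kappa>\<close> is given by the sets \<open>H \<inter> polar F\<close>, where \<open>H\<close> is a subgroup of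
  index less than \<open>\<kappa>\<close> and \<open>F\<close> is a finite set of homomorphisms into the circle. All homomorphisms
  are continuous because \<open>F\<close> is arbitrary, and these sets are quasiconvex because characters separate
  points from subgroups. For \<open>\<kappa> < \<kappa>'\<close> choose a subgroup \<open>N\<close> of index exactly \<open>\<kappa>\<close>: it is open in
  \<open>\<tau> \<kappa>'\<close>. If it contained some \<open>H \<inter> polar F\<close> with \<open>H\<close> of index less than \<open>\<kappa>\<close>, then
  it would itself have index less than \<open>\<kappa>\<close>, since finitely many translates of \<open>polar F\<close> cover the group
  even after shrinking.
\<close>

section \<open>Abelian groups as modules over the integers\<close>

text \<open>Subgroups are the submodules, \<open>zmod.subspace\<close>, of this module structure.\<close>

definition zscale :: "int \<Rightarrow> 'a::ab_group_add \<Rightarrow> 'a" where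
  "zscale k x = (if 0 \<le> k then \<Sum>i<nat k. x else - (\<Sum>i<nat (- k). x))"

lemma zscale_succ: "zscale (k + 1) x = zscale k x + x"
proof (cases "0 \<le> k")
  case True
  then have "nat (k + 1) = Suc (nat k)" by simp
  then show ?thesis using True by (simp add: zscale_def)
next
  case False
  then have "nat (- k) = Suc (nat (- (k + 1)))" by simp
  with False show ?thesis
    by (cases "k = - 1") (simp_all add: zscale_def)
qed

lemma zscale_pred: "zscale (k - 1) x = zscale k x - x"
  using zscale_succ[of "k - 1" x] by simp

lemma zscale_0: "zscale 0 x = 0"
  by (simp add: zscale_def)

lemma zscale_1: "zscale 1 x = x"
  by (simp add: zscale_def)

lemma zscale_add: "zscale (k + l) x = zscale k x + zscale l x"
proof (induction l rule: int_induct[where k = 0])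
  case (step1 i)
  then show ?case by (metis add.assoc zscale_succ)
next
  case (step2 i)
  then show ?case by (metis add_diff_eq zscale_pred)
qed (simp add: zscale_0)

interpretation zmod: module zscale
proof
  show "zscale k (x + y) = zscale k x + zscale k y" for k and x y :: 'a
    by (simp add: zscale_def sum.distrib)
  show "zscale (k + l) x = zscale k x + zscale l x" for k l and x :: 'a
    by (rule zscale_add)
  show "zscale k (zscale l x) = zscale (k * l) x" for k l and x :: 'a
  proof (induction k rule: int_induct[where k = 0])
    case (step1 i)
    then show ?case by (simp only: zscale_succ zscale_add distrib_right mult_1 zscale_1)
  next
    case (step2 i)
    then show ?case
      using zscale_add[of "i * l - l" l x] by (simp add: zscale_pred left_diff_distrib)
  qed (simp add: zscale_0)
  show "zscale 1 x = x" for x :: 'a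
    by (rule zscale_1)
qed

lemma additive_zscale:
  assumes "Modules.additive f"
  shows "f (zscale k x) = zscale k (f x)"
proof -
  interpret Modules.additive f by fact
  show ?thesis by (simp add: zscale_def sum minus)
qed

lemma zscale_Pair: "zscale k (x, y) = (zscale k x, zscale k y)"
proof -
  have "Modules.additive (fst :: 'a \<times> 'b \<Rightarrow> 'a)" "Modules.additive (snd :: 'a \<times> 'b \<Rightarrow> 'b)"
    by (simp_all add: Modules.additive_def)
  from additive_zscale[OF this(1), of k "(x, y)"] additive_zscale[OF this(2), of k "(x, y)"]
  show ?thesis by (simp add: prod_eq_iff)
qed

text \<open>Zorn's lemma. For \<open>x\<close> outside a maximal \<open>R\<close>, the subgroup
  generated by \<open>R\<close> and \<open>x\<close> must meet \<open>V\<close> outside 0, and its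
  elements have the form \<open>r + zscale k x\<close> with \<open>r\<close> in
  \<open>R\<close>.\<close>

lemma maximal_subgroup_avoiding:
  fixes R\<^sub>0 V :: "'a::ab_group_add set"
  assumes "zmod.subspace R\<^sub>0" and "R\<^sub>0 \<inter> V \<subseteq> {0}"
  obtains R where "zmod.subspace R" "R\<^sub>0 \<subseteq> R" "R \<inter> V \<subseteq> {0}"
    and "\<And>x. x \<notin> R \<Longrightarrow> \<exists>r\<in>R. \<exists>k. r + zscale k x \<in> V - {0}"
proof -
  define \<A> where "\<A> = {X. zmod.subspace X \<and> R\<^sub>0 \<subseteq> X \<and> X \<inter> V \<subseteq> {0}}"
  have "\<exists>R\<in>\<A>. \<forall>X\<in>\<A>. R \<subseteq> X \<longrightarrow> X = R"
  proof (rule subset_Zorn_nonempty)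
    show "\<A> \<noteq> {}" using assms by (auto simp: \<A>_def)
    fix \<C> assume C: "\<C> \<noteq> {}" "subset.chain \<A> \<C>"
    then have sub: "\<C> \<subseteq> \<A>" and tot: "\<And>X Y. X \<in> \<C> \<Longrightarrow> Y \<in> \<C> \<Longrightarrow> X \<subseteq> Y \<or> Y \<subseteq> X"
      by (auto simp: subset_chain_def)
    have sp: "zmod.subspace X" if "X \<in> \<C>" for X
      using that sub by (auto simp: \<A>_def)
    have "zmod.subspace (\<Union>\<C>)"
    proof (rule zmod.subspaceI)
      show "0 \<in> \<Union>\<C>" using C(1) sp zmod.subspace_0 by blast
      show "x + y \<in> \<Union>\<C>" if xy: "x \<in> \<Union>\<C>" "y \<in> \<Union>\<C>" for x y
      proof -
        obtain X Y where "X \<in> \<C>" "Y \<in> \<C>" "x \<in> X" "y \<in> Y" using xy by blast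
        with tot obtain Z where "Z \<in> \<C>" "x \<in> Z" "y \<in> Z" by blast
        then show ?thesis using sp zmod.subspace_add by blast
      qed
      show "zscale c x \<in> \<Union>\<C>" if "x \<in> \<Union>\<C>" for c x
        using that sp zmod.subspace_scale by blast
    qed
    then show "\<Union>\<C> \<in> \<A>" using C(1) sub by (auto simp: \<A>_def)
  qed
  then obtain R where R: "R \<in> \<A>" and max: "\<And>X. X \<in> \<A> \<Longrightarrow> R \<subseteq> X \<Longrightarrow> X = R" by blast
  show thesis
  proof
    show sR: "zmod.subspace R" and "R\<^sub>0 \<subseteq> R" "R \<inter> V \<subseteq> {0}" using R by (auto simp: \<A>_def)
    fix x assume x: "x \<notin> R"
    let ?X = "zmod.span (insert x R)"
    have "R \<subseteq> ?X" "x \<in> ?X" using zmod.span_superset by blast+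
    with x max have "?X \<notin> \<A>" by blast
    with \<open>R\<^sub>0 \<subseteq> R\<close> \<open>R \<subseteq> ?X\<close> obtain v where v: "v \<in> ?X" "v \<in> V" "v \<noteq> 0"
      unfolding \<A>_def by blast
    then obtain k where "v - zscale k x \<in> R"
      using sR by (metis zmod.span_breakdown_eq zmod.span_eq_iff)
    with v show "\<exists>r\<in>R. \<exists>k. r + zscale k x \<in> V - {0}"
      by (intro bexI[of _ "v - zscale k x"] exI[of _ k]) auto
  qed
qed

text \<open>The integers satisfying \<open>P\<close> form a nonzero ideal, and division with
  remainder shows that its least positive member generates it. This supplies the order of an element
  modulo a subgroup.\<close>

lemma int_ideal_generator:
  fixes P :: "int \<Rightarrow> bool"
  assumes add: "\<And>k l. P k \<Longrightarrow> P l \<Longrightarrow> P (k + l)" and mult: "\<And>c k. P k \<Longrightarrow> P (c * k)"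
    and k: "P k" "k \<noteq> 0"
  obtains n :: nat where "n > 0" "P (int n)" "\<And>m. P m \<Longrightarrow> int n dvd m"
proof -
  have "P \<bar>k\<bar>" using mult[of k "sgn k"] k by (simp add: abs_sgn mult.commute)
  with k have ex: "\<exists>n::nat. n > 0 \<and> P (int n)" by (intro exI[of _ "nat \<bar>k\<bar>"]) auto
  define n where "n = (LEAST n::nat. n > 0 \<and> P (int n))"
  have n: "n > 0" "P (int n)" using LeastI_ex[OF ex] by (simp_all add: n_def)
  have dvd: "int n dvd m" if m: "P m" for m
  proof (rule ccontr)
    assume "\<not> int n dvd m"
    then have "m mod int n \<noteq> 0" by (simp add: dvd_eq_mod_eq_0)
    moreover have "0 \<le> m mod int n" "m mod int n < int n" using n by simp_all
    ultimately have r: "0 < nat (m mod int n)" "nat (m mod int n) < n" by linarith+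
    have "P (m + (- (m div int n)) * int n)" using add[OF m mult[OF n(2)]] .
    then have "P (int (nat (m mod int n)))"
      using r by (simp add: minus_div_mult_eq_mod)
    with r not_less_Least[of "nat (m mod int n)" "\<lambda>n. n > 0 \<and> P (int n)"] show False
      by (simp add: n_def)
  qed
  show thesis by (rule that[OF n dvd])
qed

text \<open>Divisible subgroups are direct summands. Take \<open>R\<close> maximal over
  \<open>R\<^sub>0\<close> with trivial intersection with \<open>V\<close>. An \<open>x\<close>
  outside \<open>R + V\<close> could be shifted by an element of \<open>V\<close> so that its order
  modulo \<open>R + V\<close> is also its order modulo \<open>R\<close>, which contradicts
  maximality.\<close>

lemma divisible_subgroup_complement:
  fixes R\<^sub>0 V :: "'a::ab_group_add set"
  assumes R0: "zmod.subspace R\<^sub>0" "R\<^sub>0 \<inter> V \<subseteq> {0}" and V: "zmod.subspace V"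
    and div: "\<And>v k. v \<in> V \<Longrightarrow> k > 0 \<Longrightarrow> \<exists>w\<in>V. zscale k w = v"
  obtains R where "zmod.subspace R" "R\<^sub>0 \<subseteq> R" "R \<inter> V \<subseteq> {0}" "\<And>x. \<exists>v\<in>V. x - v \<in> R"
proof -
  obtain R where R: "zmod.subspace R" "R\<^sub>0 \<subseteq> R" "R \<inter> V \<subseteq> {0}"
    and max: "\<And>x. x \<notin> R \<Longrightarrow> \<exists>r\<in>R. \<exists>k. r + zscale k x \<in> V - {0}"
    using maximal_subgroup_avoiding[OF R0] by blast
  have "\<exists>v\<in>V. x - v \<in> R" for x
  proof (rule ccontr)
    assume no: "\<not> ?thesis"
    \<comment> \<open>\<open>?P k y\<close> says that the multiple of \<open>y\<close> by
      \<open>k\<close> lies in \<open>R + V\<close>; for fixed \<open>y\<close> these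
      \<open>k\<close> form an ideal.\<close>
    let ?P = "\<lambda>k y. \<exists>v\<in>V. zscale k y - v \<in> R"
    have P_add: "?P (k + l) y" if "?P k y" "?P l y" for k l y
    proof -
      from that obtain v w where vw: "v \<in> V" "w \<in> V" "zscale k y - v \<in> R" "zscale l y - w \<in> R"
        by blast
      then have "zscale (k + l) y - (v + w) \<in> R"
        using zmod.subspace_add[OF R(1) vw(3,4)] by (simp add: zmod.scale_left_distrib algebra_simps)
      with vw V show ?thesis by (meson zmod.subspace_add)
    qed
    have P_mult: "?P (c * k) y" if "?P k y" for c k y
    proof -
      from that obtain v where v: "v \<in> V" "zscale k y - v \<in> R" by blast
      then have "zscale (c * k) y - zscale c v \<in> R"
        using zmod.subspace_scale[OF R(1) v(2), of c] by (simp add: zmod.scale_right_diff_distrib)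
      with v V show ?thesis by (meson zmod.subspace_scale)
    qed
    have max': "\<exists>k. k \<noteq> 0 \<and> ?P k y" if y: "y \<notin> R" for y
    proof -
      obtain r k where rk: "r \<in> R" "r + zscale k y \<in> V - {0}" using max[OF y] by blast
      have "k \<noteq> 0" using rk R(3) by auto
      moreover have "zscale k y - (r + zscale k y) \<in> R"
        using zmod.subspace_neg[OF R(1) rk(1)] by simp
      ultimately show ?thesis using rk by blast
    qed
    have "x \<notin> R" using no zmod.subspace_0[OF V] by force
    then obtain k where k: "k \<noteq> 0" "?P k x" using max' by blast
    have "\<exists>n::nat. n > 0 \<and> ?P (int n) x \<and> (\<forall>m. ?P m x \<longrightarrow> int n dvd m)"
      by (rule int_ideal_generator[of "\<lambda>k. ?P k x", OF P_add P_mult k(2,1)]) blast+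
    then obtain n :: nat where n: "n > 0" "?P (int n) x" and dvd: "\<And>m. ?P m x \<Longrightarrow> int n dvd m"
      by blast
    obtain v where v: "v \<in> V" "zscale (int n) x - v \<in> R" using n by blast
    \<comment> \<open>Divisibility of \<open>V\<close> enters here: the multiple of
      \<open>x - w\<close> by \<open>n\<close> lies in \<open>R\<close> itself, not merely in
      \<open>R + V\<close>.\<close>
    obtain w where w: "w \<in> V" "zscale (int n) w = v" using div[OF v(1), of "int n"] n by auto
    have nx: "zscale (int n) (x - w) \<in> R" using v w by (simp add: zmod.scale_right_diff_distrib)
    have "x - w \<notin> R" using no w by blast
    then obtain r m where rm: "r \<in> R" "r + zscale m (x - w) \<in> V" "r + zscale m (x - w) \<noteq> 0"
      using max by blast
    \<comment> \<open>The difference is \<open>- r\<close>. Hence the multiple of \<open>x\<close>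
      by \<open>m\<close> lies in \<open>R + V\<close>, which forces \<open>n\<close> to divide
      \<open>m\<close>.\<close>
    have "zscale m x - (r + zscale m (x - w) + zscale m w) \<in> R"
      using zmod.subspace_neg[OF R(1) rm(1)] by (simp add: zmod.scale_right_diff_distrib)
    moreover have "r + zscale m (x - w) + zscale m w \<in> V"
      using rm w V zmod.subspace_add zmod.subspace_scale by blast
    ultimately have "int n dvd m" using dvd by blast
    then obtain c where "m = c * int n" by (metis dvdE mult.commute)
    then have "zscale m (x - w) \<in> R"
      using zmod.subspace_scale[OF R(1) nx, of c] by simp
    then have "r + zscale m (x - w) \<in> R" using rm R zmod.subspace_add by blast
    with rm R(3) show False by blast
  qed
  then show thesis by (rule that[OF R])
qed

section \<open>Characters\<close>

lemma to_circle_eq_iff: "to_circle r = to_circle s \<longleftrightarrow> r - s \<in> \<int>"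
  using circle.abs_eq_iff circle_rel_def by auto

lemma to_circle_rep [simp]: "to_circle (rep_circle t) = t"
  by (meson Quotient3_abs_rep Quotient3_circle)

lemma to_circle_simps:
  "to_circle 0 = 0" "to_circle (r + s) = to_circle r + to_circle s"
  "to_circle (r - s) = to_circle r - to_circle s" "to_circle (- r) = - to_circle r"
  by (simp_all add: zero_circle_def plus_circle.abs_eq minus_circle.abs_eq uminus_circle.abs_eq)

lemma zscale_to_circle: "zscale k (to_circle r) = to_circle (of_int k * r)"
proof -
  have "Modules.additive to_circle" by (simp add: Modules.additive_def to_circle_simps)
  moreover have "zscale k r = of_int k * r" by (simp add: zscale_def)
  ultimately show ?thesis using additive_zscale by metis
qed

lemma to_circle_in_circle_plus: "to_circle r \<in> circle_plus \<longleftrightarrow> (\<exists>z::int. \<bar>r - of_int z\<bar> \<le> 1 / 4)"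
proof
  assume "to_circle r \<in> circle_plus"
  then obtain s where "s \<in> {- (1 / 4) .. 1 / 4}" "to_circle r = to_circle s"
    unfolding circle_plus_def by blast
  then have s: "\<bar>s\<bar> \<le> 1 / 4" "r - s \<in> \<int>" by (auto simp: to_circle_eq_iff abs_le_iff)
  then obtain z where "r - s = of_int z" by (auto elim: Ints_cases)
  with s show "\<exists>z::int. \<bar>r - of_int z\<bar> \<le> 1 / 4" by (intro exI[of _ z]) (simp add: algebra_simps)
next
  assume "\<exists>z::int. \<bar>r - of_int z\<bar> \<le> 1 / 4"
  then obtain z :: int where "\<bar>r - of_int z\<bar> \<le> 1 / 4" by blast
  have "to_circle r = to_circle (r - of_int z)" by (simp add: to_circle_eq_iff)
  moreover have "r - of_int z \<in> {- (1 / 4) .. 1 / 4}"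
    using \<open>\<bar>r - of_int z\<bar> \<le> 1 / 4\<close> unfolding atLeastAtMost_iff by linarith
  ultimately show "to_circle r \<in> circle_plus"
    unfolding circle_plus_def by blast
qed

lemma zero_in_circle_plus [simp]: "0 \<in> circle_plus"
  unfolding to_circle_simps(1)[symmetric] to_circle_in_circle_plus by (intro exI[of _ 0]) simp

lemma uminus_in_circle_plus [simp]: "- t \<in> circle_plus \<longleftrightarrow> t \<in> circle_plus"
proof -
  have "- t \<in> circle_plus" if "t \<in> circle_plus" for t
  proof -
    from that obtain r where "t = to_circle r" "\<bar>r\<bar> \<le> 1 / 4"
      by (auto simp: circle_plus_def)
    then show ?thesis
      by (auto simp: to_circle_simps(4)[symmetric] to_circle_in_circle_plus intro!: exI[of _ 0])
  qed
  from this this[of "- t"] show ?thesis by auto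
qed

text \<open>Doubling a point of an arc that is already known to lie within the quarter arc does not wrap around.\<close>

lemma circle_plus_doubling:
  assumes "\<And>k. k \<le> n \<Longrightarrow> zscale (2 ^ k) t \<in> circle_plus"
  obtains r where "t = to_circle r" "\<bar>r\<bar> \<le> 1 / (4 * 2 ^ n)"
proof -
  have "t \<in> circle_plus" using assms[of 0] by simp
  then obtain r where r: "t = to_circle r" "\<bar>r\<bar> \<le> 1 / 4"
    by (auto simp: circle_plus_def)
  have "\<bar>r\<bar> * 2 ^ k \<le> 1 / 4" if "k \<le> n" for k
    using that
  proof (induction k)
    case (Suc k)
    then have IH: "\<bar>r\<bar> * 2 ^ k \<le> 1 / 4" by simp
    obtain z :: int where z: "\<bar>2 ^ Suc k * r - of_int z\<bar> \<le> 1 / 4"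
      using assms[OF Suc.prems] by (auto simp: r zscale_to_circle to_circle_in_circle_plus)
    \<comment> \<open>The doubled value is at most 1/2 in modulus, so an integer within 1/4 of it
      has modulus at most 3/4 and is 0.\<close>
    have b: "\<bar>2 ^ Suc k * r\<bar> \<le> 1 / 2" using IH by (simp add: abs_mult mult.commute mult.left_commute)
    then have "\<bar>real_of_int z\<bar> < 1" using z by linarith
    then have "z = 0" by linarith
    with z show ?case by (simp add: abs_mult mult.commute)
  qed (use r in simp)
  from this[of n] r that[of r] show thesis by (simp add: field_simps)
qed

lemma to_circle_not_in_circle_plus:
  assumes "1 / 4 < r" "r < 3 / 4"
  shows "to_circle r \<notin> circle_plus"
proof
  assume "to_circle r \<in> circle_plus"
  then obtain z :: int where z: "\<bar>r - of_int z\<bar> \<le> 1 / 4"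
    by (auto simp: to_circle_in_circle_plus)
  then have "z < 1" "z > 0" using assms by linarith+
  then show False by simp
qed

lemma circle_divisible:
  fixes v :: circle
  assumes "k > 0"
  shows "\<exists>w. zscale k w = v"
proof
  show "zscale k (to_circle (rep_circle v / of_int k)) = v"
    using assms by (simp add: zscale_to_circle)
qed

text \<open>
  The graph of the required character is a complement of the divisible subgroup \<open>0 \<times> circle\<close>
  of \<open>G \<times> circle\<close> that contains \<open>H \<times> 0\<close> and a suitable point above \<open>g\<close>.
\<close>

lemma character_separating_subgroup:
  fixes H :: "'a::ab_group_add set"
  assumes H: "zmod.subspace H" and g: "g \<notin> H"
  obtains \<phi> where "Modules.additive \<phi>" "\<And>h. h \<in> H \<Longrightarrow> \<phi> h = 0" "\<phi> g \<notin> circle_plus"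
proof -
  \<comment> \<open>\<open>t\<close> is the future value at \<open>g\<close>. It must be annihilated
    by every integer that carries \<open>g\<close> into \<open>H\<close>.\<close>
  obtain t where t: "t \<notin> circle_plus" "\<And>m. zscale m g \<in> H \<Longrightarrow> zscale m t = 0"
  proof (cases "\<exists>k. zscale k g \<in> H \<and> k \<noteq> 0")
    case True
    then obtain k where k: "zscale k g \<in> H" "k \<noteq> 0" by blast
    have add: "zscale (k + l) g \<in> H" if "zscale k g \<in> H" "zscale l g \<in> H" for k l
      using zmod.subspace_add[OF H that] by (simp add: zmod.scale_left_distrib)
    have mult: "zscale (c * k) g \<in> H" if "zscale k g \<in> H" for c k
      using zmod.subspace_scale[OF H that, of c] by simp
    obtain n :: nat where n: "n > 0" "zscale (int n) g \<in> H"
      and dvd: "\<And>m. zscale m g \<in> H \<Longrightarrow> int n dvd m"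
      by (rule int_ideal_generator[of "\<lambda>k. zscale k g \<in> H", OF add mult k]) blast+
    have "n \<noteq> 1" using n g by auto
    with n have n2: "n \<ge> 2" by simp
    \<comment> \<open>Here \<open>n\<close> is the order of \<open>g\<close> modulo
      \<open>H\<close>. The fraction is killed by \<open>n\<close> on the circle and lies strictly
      between 1/4 and 3/4 for every \<open>n \<ge> 2\<close>.\<close>
    define r where "r = real (n div 2) / real n"
    have "n < 4 * (n div 2)" "4 * (n div 2) < 3 * n" using n2 by presburger+
    then have "real n < 4 * real (n div 2)" "4 * real (n div 2) < 3 * real n"
      by linarith+
    then have "1 / 4 < r" "r < 3 / 4" using n by (simp_all add: r_def field_simps)
    then have 1: "to_circle r \<notin> circle_plus" by (rule to_circle_not_in_circle_plus)
    have 2: "zscale m (to_circle r) = 0" if "zscale m g \<in> H" for m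
    proof -
      obtain c where "m = int n * c" using dvd[OF \<open>zscale m g \<in> H\<close>] by blast
      then have "of_int m * r = of_int (c * int (n div 2))" using n by (simp add: r_def)
      then show ?thesis
        by (simp add: zscale_to_circle to_circle_simps(1)[symmetric] to_circle_eq_iff del: of_int_mult)
    qed
    show ?thesis using that 1 2 by blast
  next
    case False
    have z: "zscale m t = 0" if "zscale m g \<in> H" for m and t :: circle
    proof -
      have "m = 0" using False that by blast
      then show ?thesis by simp
    qed
    have "to_circle (1 / 2) \<notin> circle_plus" by (rule to_circle_not_in_circle_plus) simp_all
    then show ?thesis using z by (rule that)
  qed
  \<comment> \<open>The graph of the partial homomorphism on the subgroup generated by
    \<open>H\<close> and \<open>g\<close> that kills \<open>H\<close> and sends \<open>g\<close> to
    \<open>t\<close>; trivial intersection with \<open>V\<close> expresses that it is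
    single-valued.\<close>
  define R\<^sub>0 :: "('a \<times> circle) set" where "R\<^sub>0 = {(h + zscale m g, zscale m t) |h m. h \<in> H}"
  have R\<^sub>0I: "(h + zscale m g, zscale m t) \<in> R\<^sub>0" if "h \<in> H" for h m
    using that unfolding R\<^sub>0_def by blast
  define V where "V = {0 :: 'a} \<times> (UNIV :: circle set)"
  have R0: "zmod.subspace R\<^sub>0"
  proof (rule zmod.subspaceI)
    show "0 \<in> R\<^sub>0"
      using R\<^sub>0I[OF zmod.subspace_0[OF H], of 0] by (simp add: zero_prod_def)
    show "x + y \<in> R\<^sub>0" if xy: "x \<in> R\<^sub>0" "y \<in> R\<^sub>0" for x y
    proof -
      obtain h m h' m' where "x = (h + zscale m g, zscale m t)" "y = (h' + zscale m' g, zscale m' t)"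
        and "h \<in> H" "h' \<in> H" using xy unfolding R\<^sub>0_def by blast
      then have "x + y = ((h + h') + zscale (m + m') g, zscale (m + m') t)" "h + h' \<in> H"
        using zmod.subspace_add[OF H] by (auto simp: zmod.scale_left_distrib algebra_simps)
      then show ?thesis using R\<^sub>0I by simp
    qed
    show "zscale c x \<in> R\<^sub>0" if x: "x \<in> R\<^sub>0" for c x
    proof -
      obtain h m where "x = (h + zscale m g, zscale m t)" "h \<in> H" using x unfolding R\<^sub>0_def by blast
      then have "zscale c x = (zscale c h + zscale (c * m) g, zscale (c * m) t)" "zscale c h \<in> H"
        using zmod.subspace_scale[OF H] by (auto simp: zscale_Pair zmod.scale_right_distrib)
      then show ?thesis using R\<^sub>0I by simp
    qed
  qed
  have R0V: "R\<^sub>0 \<inter> V \<subseteq> {0}"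
  proof
    fix x assume "x \<in> R\<^sub>0 \<inter> V"
    then obtain h m where x: "x = (0, zscale m t)" "h \<in> H" "h + zscale m g = 0"
      by (auto simp: R\<^sub>0_def V_def)
    then have "zscale m g = - h" by (simp add: eq_neg_iff_add_eq_0 add.commute)
    then have "zscale m g \<in> H" using x zmod.subspace_neg[OF H] by simp
    with t x show "x \<in> {0}" by (simp add: zero_prod_def)
  qed
  have V: "zmod.subspace V"
    by (rule zmod.subspaceI) (auto simp: V_def zero_prod_def zscale_Pair)
  have div: "\<exists>w\<in>V. zscale k w = v" if "v \<in> V" "k > 0" for v k
  proof -
    obtain w where "zscale k w = snd v" using circle_divisible[OF \<open>k > 0\<close>] by blast
    with that show ?thesis by (intro bexI[of _ "(0, w)"]) (auto simp: V_def zscale_Pair)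
  qed
  obtain R where R: "zmod.subspace R" "R\<^sub>0 \<subseteq> R" "R \<inter> V \<subseteq> {0}" "\<And>x. \<exists>v\<in>V. x - v \<in> R"
    using divisible_subgroup_complement[OF R0 R0V V div] by blast
  \<comment> \<open>That \<open>R\<close> and \<open>V\<close> span makes the relation
    \<open>R\<close> total, and their trivial intersection makes it single-valued, so
    \<open>R\<close> is the graph of a homomorphism.\<close>
  have ex: "\<exists>s. (x, s) \<in> R" for x
    using R(4)[of "(x, 0)"] by (auto simp: V_def)
  have uniq: "s = s'" if "(x, s) \<in> R" "(x, s') \<in> R" for x s s'
  proof -
    have "(0, s - s') \<in> R \<inter> V" using zmod.subspace_diff[OF R(1) that] by (simp add: V_def)
    with R(3) have "(0, s - s') = (0 :: 'a \<times> circle)" by blast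
    then show ?thesis by (simp add: zero_prod_def)
  qed
  obtain \<phi> where \<phi>: "\<And>x. (x, \<phi> x) \<in> R" using ex by metis
  show thesis
  proof
    show "Modules.additive \<phi>"
      unfolding Modules.additive_def
    proof (intro allI)
      fix x y
      have "(x + y, \<phi> x + \<phi> y) \<in> R" using zmod.subspace_add[OF R(1) \<phi> \<phi>, of x y] by simp
      then show "\<phi> (x + y) = \<phi> x + \<phi> y" using uniq \<phi> by blast
    qed
    show "\<phi> h = 0" if "h \<in> H" for h
    proof -
      have "(h, 0) \<in> R\<^sub>0" using R\<^sub>0I[OF that, of 0] by simp
      then show ?thesis using R(2) uniq \<phi> by blast
    qed
    have "(g, t) \<in> R\<^sub>0" using R\<^sub>0I[OF zmod.subspace_0[OF H], of 1] by simp
    then have "\<phi> g = t" using R(2) uniq \<phi> by blast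
    then show "\<phi> g \<notin> circle_plus" using t by simp
  qed
qed

section \<open>Group topologies from neighbourhood bases\<close>

text \<open>Translates of members of \<open>\<B>\<close> are meant as neighbourhoods. The axioms of
  \<open>group_base\<close> ensure that the predicate under \<open>topology\<close> really is a
  topology.\<close>

definition base_topology :: "'a::ab_group_add set set \<Rightarrow> 'a topology" where
  "base_topology \<B> = topology (\<lambda>U. \<forall>x\<in>U. \<exists>B\<in>\<B>. \<forall>b\<in>B. x + b \<in> U)"

text \<open>The usual axioms for a neighbourhood base at 0 of a group topology. Members are
  neighbourhoods but are not assumed open.\<close>

locale group_base =
  fixes \<B> :: "'a::ab_group_add set set"
  assumes nonempty: "\<B> \<noteq> {}"
    and zero: "B \<in> \<B> \<Longrightarrow> 0 \<in> B"
    and directed: "A \<in> \<B> \<Longrightarrow> B \<in> \<B> \<Longrightarrow> \<exists>C\<in>\<B>. C \<subseteq> A \<inter> B"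
    and half: "B \<in> \<B> \<Longrightarrow> \<exists>C\<in>\<B>. \<forall>x\<in>C. \<forall>y\<in>C. x + y \<in> B"
    and neg: "B \<in> \<B> \<Longrightarrow> x \<in> B \<Longrightarrow> - x \<in> B"
begin

lemma openin_base_topology:
  "openin (base_topology \<B>) U \<longleftrightarrow> (\<forall>x\<in>U. \<exists>B\<in>\<B>. \<forall>b\<in>B. x + b \<in> U)"
proof -
  have "istopology (\<lambda>U. \<forall>x\<in>U. \<exists>B\<in>\<B>. \<forall>b\<in>B. x + b \<in> U)"
    unfolding istopology_def
  proof (intro conjI allI impI ballI)
    fix U V x
    assume UV: "\<forall>x\<in>U. \<exists>B\<in>\<B>. \<forall>b\<in>B. x + b \<in> U" "\<forall>x\<in>V. \<exists>B\<in>\<B>. \<forall>b\<in>B. x + b \<in> V"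
      and x: "x \<in> U \<inter> V"
    then obtain A B where AB: "A \<in> \<B>" "B \<in> \<B>" "\<forall>b\<in>A. x + b \<in> U" "\<forall>b\<in>B. x + b \<in> V" by blast
    then obtain C where "C \<in> \<B>" "C \<subseteq> A \<inter> B" using directed by blast
    with AB show "\<exists>B\<in>\<B>. \<forall>b\<in>B. x + b \<in> U \<inter> V" by blast
  next
    fix \<K> x
    assume "\<forall>K\<in>\<K>. \<forall>x\<in>K. \<exists>B\<in>\<B>. \<forall>b\<in>B. x + b \<in> K" "x \<in> \<Union>\<K>"
    then show "\<exists>B\<in>\<B>. \<forall>b\<in>B. x + b \<in> \<Union>\<K>" by (meson UnionE UnionI)
  qed
  then show ?thesis by (simp add: base_topology_def)
qed

lemma topspace_base_topology: "topspace (base_topology \<B>) = UNIV"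
proof -
  have "openin (base_topology \<B>) UNIV" using nonempty by (auto simp: openin_base_topology)
  then show ?thesis using openin_subset by blast
qed

lemma open_neighbourhood:
  assumes B: "B \<in> \<B>"
  obtains U where "openin (base_topology \<B>) U" "x \<in> U" "\<And>u. u \<in> U \<Longrightarrow> u - x \<in> B"
proof
  \<comment> \<open>This is the interior of the translate of \<open>B\<close> by \<open>x\<close>;
    halving the neighbourhood \<open>C\<close> shows that it is open.\<close>
  let ?U = "{u. \<exists>C\<in>\<B>. \<forall>c\<in>C. u + c - x \<in> B}"
  show "openin (base_topology \<B>) ?U"
    unfolding openin_base_topology
  proof
    fix u assume "u \<in> ?U"
    then obtain C where C: "C \<in> \<B>" "\<forall>c\<in>C. u + c - x \<in> B" by blast
    then obtain D where D: "D \<in> \<B>" "\<forall>c\<in>D. \<forall>d\<in>D. c + d \<in> C" using half by blast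
    have "u + c \<in> ?U" if "c \<in> D" for c
      using C D that by (auto simp: add.assoc intro!: bexI[of _ D])
    then show "\<exists>B\<in>\<B>. \<forall>b\<in>B. u + b \<in> ?U" using D by blast
  qed
  show "x \<in> ?U" using B by auto
  show "u - x \<in> B" if "u \<in> ?U" for u
  proof -
    from that obtain C where "C \<in> \<B>" "\<forall>c\<in>C. u + c - x \<in> B" by blast
    then show ?thesis using zero by fastforce
  qed
qed

lemma group_topology_base_topology: "group_topology (base_topology \<B>)"
  unfolding group_topology_def
proof (intro conjI)
  let ?T = "base_topology \<B>"
  show "topspace ?T = UNIV" by (rule topspace_base_topology)
  show "continuous_map ?T ?T uminus"
    unfolding continuous_map_def
  proof (intro conjI allI impI)
    fix U assume "openin ?T U"
    then have U: "\<exists>B\<in>\<B>. \<forall>b\<in>B. x + b \<in> U" if "x \<in> U" for x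
      using that by (simp add: openin_base_topology)
    have "\<exists>B\<in>\<B>. \<forall>b\<in>B. - (x + b) \<in> U" if "- x \<in> U" for x
    proof -
      obtain B where B: "B \<in> \<B>" "\<forall>b\<in>B. - x + b \<in> U" using U[OF \<open>- x \<in> U\<close>] by blast
      have "- (x + b) \<in> U" if "b \<in> B" for b
        using bspec[OF B(2) neg[OF B(1) that]] by (simp add: minus_add_distrib)
      with B show ?thesis by blast
    qed
    then show "openin ?T {x \<in> topspace ?T. - x \<in> U}"
      by (simp add: openin_base_topology topspace_base_topology)
  qed (simp add: topspace_base_topology)
  show "continuous_map (prod_topology ?T ?T) ?T (\<lambda>(x, y). x + y)"
    unfolding continuous_map_def
  proof (intro conjI allI impI)
    fix U assume U: "openin ?T U"
    show "openin (prod_topology ?T ?T) {p \<in> topspace (prod_topology ?T ?T). (case p of (x, y) \<Rightarrow> x + y) \<in> U}"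
      unfolding openin_prod_topology_alt
    proof (intro allI impI)
      fix x y
      assume "(x, y) \<in> {p \<in> topspace (prod_topology ?T ?T). (case p of (x, y) \<Rightarrow> x + y) \<in> U}"
      then have "x + y \<in> U" by simp
      then obtain B where B: "B \<in> \<B>" "\<forall>b\<in>B. x + y + b \<in> U"
        using U by (auto simp: openin_base_topology)
      then obtain C where C: "C \<in> \<B>" "\<forall>c\<in>C. \<forall>d\<in>C. c + d \<in> B" using half by blast
      obtain V where V: "openin ?T V" "x \<in> V" "\<And>u. u \<in> V \<Longrightarrow> u - x \<in> C"
        using open_neighbourhood[OF C(1)] by blast
      obtain W where W: "openin ?T W" "y \<in> W" "\<And>u. u \<in> W \<Longrightarrow> u - y \<in> C"
        using open_neighbourhood[OF C(1)] by blast
      have "v + w \<in> U" if "v \<in> V" "w \<in> W" for v w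
      proof -
        have "x + y + ((v - x) + (w - y)) \<in> U" using B C V W that by blast
        then show ?thesis by (simp add: algebra_simps)
      qed
      with V W show "\<exists>V W. openin ?T V \<and> openin ?T W \<and> x \<in> V \<and> y \<in> W \<and>
        V \<times> W \<subseteq> {p \<in> topspace (prod_topology ?T ?T). (case p of (x, y) \<Rightarrow> x + y) \<in> U}"
        by (intro exI[of _ V] exI[of _ W]) (auto simp: topspace_base_topology)
    qed
  qed (simp add: topspace_base_topology)
qed

lemma locally_quasiconvex_base_topology:
  assumes "\<And>B. B \<in> \<B> \<Longrightarrow> quasiconvex (base_topology \<B>) B"
  shows "locally_quasiconvex (base_topology \<B>)"
  unfolding locally_quasiconvex_def neighbourhood_base_at_def
proof (intro allI impI)
  fix W assume W: "openin (base_topology \<B>) W \<and> 0 \<in> W"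
  then obtain B where B: "B \<in> \<B>" "\<forall>b\<in>B. 0 + b \<in> W" unfolding openin_base_topology by blast
  obtain U where "openin (base_topology \<B>) U" "0 \<in> U" "\<And>u. u \<in> U \<Longrightarrow> u - 0 \<in> B"
    using open_neighbourhood[OF B(1)] by blast
  with B assms show "\<exists>U V. openin (base_topology \<B>) U \<and> quasiconvex (base_topology \<B>) V \<and>
      0 \<in> U \<and> U \<subseteq> V \<and> V \<subseteq> W"
    by (intro exI[of _ U] exI[of _ B]) auto
qed

text \<open>If the first \<open>n\<close> doublings of a value stay in the quarter arc, the value is
  within \<open>1 / (4 * 2 ^ n)\<close> of 0. The assumption \<open>small\<close> is therefore
  continuity at 0, phrased through \<open>circle_plus\<close> alone.\<close>

lemma character_base_topology:
  assumes \<phi>: "Modules.additive \<phi>"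
    and small: "\<And>n. \<exists>B\<in>\<B>. \<forall>b\<in>B. \<forall>k\<le>n. zscale (2 ^ k) (\<phi> b) \<in> circle_plus"
  shows "\<phi> \<in> characters (base_topology \<B>)"
proof -
  have "openin (base_topology \<B>) {x. \<phi> x \<in> W}" if W: "open W" for W
    unfolding openin_base_topology
  proof
    fix x assume "x \<in> {x. \<phi> x \<in> W}"
    then have "rep_circle (\<phi> x) \<in> to_circle -` W" by simp
    with W obtain e where e: "e > 0" "\<And>s. dist s (rep_circle (\<phi> x)) < e \<Longrightarrow> to_circle s \<in> W"
      by (auto simp: open_circle_def open_dist simp del: to_circle_rep)
    obtain n where n: "(1 / 2) ^ n < e" using real_arch_pow_inv[of e "1 / 2"] e by auto
    obtain B where B: "B \<in> \<B>" "\<And>b k. b \<in> B \<Longrightarrow> k \<le> n \<Longrightarrow> zscale (2 ^ k) (\<phi> b) \<in> circle_plus"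
      using small[of n] by blast
    have "\<phi> (x + b) \<in> W" if b: "b \<in> B" for b
    proof -
      obtain r where r: "\<phi> b = to_circle r" "\<bar>r\<bar> \<le> 1 / (4 * 2 ^ n)"
        using circle_plus_doubling[OF B(2)[OF b]] by blast
      have "1 / (4 * 2 ^ n) \<le> ((1 / 2) ^ n :: real)" by (simp add: field_simps)
      with r n have "\<bar>r\<bar> < e" by linarith
      then have "to_circle (rep_circle (\<phi> x) + r) \<in> W" by (intro e) (simp add: dist_real_def)
      then show ?thesis using \<phi> r by (simp add: to_circle_simps Modules.additive_def)
    qed
    with B show "\<exists>B\<in>\<B>. \<forall>b\<in>B. x + b \<in> {x. \<phi> x \<in> W}" by blast
  qed
  with \<phi> show ?thesis
    by (simp add: characters_def continuous_map_def topspace_base_topology)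
qed

end

section \<open>Subgroups of small index and polars of finite sets\<close>

definition polar :: "('a \<Rightarrow> circle) set \<Rightarrow> 'a set" where
  "polar F = {x. \<forall>\<phi>\<in>F. \<phi> x \<in> circle_plus}"

text \<open>Covering by fewer than \<open>\<kappa>\<close> cosets avoids forming the quotient group;
  \<open>T\<close> may contain several representatives of one coset.\<close>

definition index_less :: "'b rel \<Rightarrow> 'a::ab_group_add set \<Rightarrow> bool" where
  "index_less \<kappa> H \<longleftrightarrow> (\<exists>T. |T| <o \<kappa> \<and> (\<forall>x. \<exists>t\<in>T. x - t \<in> H))"

definition polar_base :: "'b rel \<Rightarrow> 'a::ab_group_add set set" where
  "polar_base \<kappa> = {H \<inter> polar F |H F. zmod.subspace H \<and> index_less \<kappa> H \<and>
     finite F \<and> F \<subseteq> Collect Modules.additive}"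

lemma polar_baseI:
  assumes "zmod.subspace H" "index_less \<kappa> H" "finite F" "F \<subseteq> Collect Modules.additive"
  shows "H \<inter> polar F \<in> polar_base \<kappa>"
  using assms unfolding polar_base_def by blast

lemma polar_baseE:
  assumes "B \<in> polar_base \<kappa>"
  obtains H F where "B = H \<inter> polar F" "zmod.subspace H" "index_less \<kappa> H"
    "finite F" "F \<subseteq> Collect Modules.additive"
  using assms unfolding polar_base_def by blast

lemma polar_empty [simp]: "polar {} = UNIV"
  by (simp add: polar_def)

section \<open>Cardinal arithmetic and intersections of subgroups of small index\<close>

lemma infinite_Field:
  assumes "Card_order \<kappa>" "natLeq \<le>o \<kappa>"
  shows "infinite (Field \<kappa>)"
  using ordLeq_ordIso_trans[OF assms(2) ordIso_symmetric[OF card_of_Field_ordIso[OF assms(1)]]]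
  using infinite_iff_natLeq_ordLeq by blast

lemma finite_ordLess:
  assumes "Card_order \<kappa>" "natLeq \<le>o \<kappa>" "finite A"
  shows "|A| <o \<kappa>"
  using assms infinite_Field[OF assms(1,2)]
  by (intro finite_ordLess_infinite) (simp_all add: card_order_on_well_order_on card_of_well_order_on Field_card_of)

text \<open>If both factors are finite, so is the product, which is then below the infinite
  \<open>\<kappa>\<close>. Otherwise the larger factor is infinite and the product is no larger than
  it.\<close>

lemma Times_ordLess:
  assumes \<kappa>: "Card_order \<kappa>" "natLeq \<le>o \<kappa>" and "|A| <o \<kappa>" "|B| <o \<kappa>"
  shows "|A \<times> B| <o \<kappa>"
proof (cases "finite A \<and> finite B")
  case True
  then show ?thesis by (intro finite_ordLess[OF \<kappa>]) simp
next
  case False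
  have "|A| \<le>o |B| \<or> |B| \<le>o |A|" by (rule ordLeq_total[OF card_of_Well_order card_of_Well_order])
  then show ?thesis
  proof
    assume le: "|A| \<le>o |B|"
    with False have "infinite B" using card_of_ordLeq_finite[OF le] by metis
    then have "|A \<times> B| \<le>o |B|"
      using le by (intro card_of_Times_ordLeq_infinite_Field) (simp_all add: Field_card_of card_of_card_order_on card_of_refl ordIso_imp_ordLeq)
    then show ?thesis by (rule ordLeq_ordLess_trans[OF _ assms(4)])
  next
    assume le: "|B| \<le>o |A|"
    with False have "infinite A" using card_of_ordLeq_finite[OF le] by metis
    then have "|A \<times> B| \<le>o |A|"
      using le by (intro card_of_Times_ordLeq_infinite_Field) (simp_all add: Field_card_of card_of_card_order_on card_of_refl ordIso_imp_ordLeq)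
    then show ?thesis by (rule ordLeq_ordLess_trans[OF _ assms(3)])
  qed
qed

text \<open>A coset of \<open>H \<inter> K\<close> is a nonempty intersection of a coset of
  \<open>H\<close> with one of \<open>K\<close>, and there are fewer than \<open>\<kappa>\<close>
  pairs of representatives.\<close>

lemma index_less_Int:
  fixes H K :: "'a::ab_group_add set"
  assumes \<kappa>: "Card_order \<kappa>" "natLeq \<le>o \<kappa>" and H: "zmod.subspace H" "index_less \<kappa> H"
    and K: "zmod.subspace K" "index_less \<kappa> K"
  shows "index_less \<kappa> (H \<inter> K)"
proof -
  obtain S where S: "|S| <o \<kappa>" "\<And>x. \<exists>t\<in>S. x - t \<in> H" using H by (auto simp: index_less_def)
  obtain T where T: "|T| <o \<kappa>" "\<And>x. \<exists>t\<in>T. x - t \<in> K" using K by (auto simp: index_less_def)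
  \<comment> \<open>A common point of the two cosets; the value is arbitrary when they are disjoint,
    but below it is used only for a pair whose cosets share \<open>x\<close>.\<close>
  define f where "f = (\<lambda>(s, t). SOME u. u - s \<in> H \<and> u - t \<in> K)"
  have "\<exists>v\<in>f ` (S \<times> T). x - v \<in> H \<inter> K" for x
  proof -
    obtain s where s: "s \<in> S" "x - s \<in> H" using S(2) by blast
    obtain t where t: "t \<in> T" "x - t \<in> K" using T(2) by blast
    from s t have "\<exists>u. u - s \<in> H \<and> u - t \<in> K" by blast
    then have "f (s, t) - s \<in> H \<and> f (s, t) - t \<in> K"
      unfolding f_def prod.case by (rule someI_ex)
    then have "(x - s) - (f (s, t) - s) \<in> H" "(x - t) - (f (s, t) - t) \<in> K"
      by (simp_all only: zmod.subspace_diff[OF H(1) s(2)] zmod.subspace_diff[OF K(1) t(2)])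
    then show ?thesis using s(1) t(1) by (intro bexI[of _ "f (s, t)"]) simp_all
  qed
  moreover have "|f ` (S \<times> T)| <o \<kappa>"
    by (rule ordLeq_ordLess_trans[OF card_of_image Times_ordLess[OF \<kappa> S(1) T(1)]])
  ultimately show ?thesis unfolding index_less_def by (intro exI[of _ "f ` (S \<times> T)"]) simp
qed

lemma index_less_UNIV:
  assumes "Card_order \<kappa>" "natLeq \<le>o \<kappa>"
  shows "index_less \<kappa> (UNIV :: 'a::ab_group_add set)"
  unfolding index_less_def
  using finite_ordLess[OF assms, of "{0 :: 'a}"] by (intro exI[of _ "{0}"]) auto

section \<open>The topologies defined by polars\<close>

lemma group_base_polar_base:
  assumes \<kappa>: "Card_order \<kappa>" "natLeq \<le>o \<kappa>"
  shows "group_base (polar_base \<kappa> :: 'a::ab_group_add set set)"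
proof
  have "UNIV \<inter> polar {} \<in> (polar_base \<kappa> :: 'a set set)"
    by (rule polar_baseI) (simp_all add: index_less_UNIV[OF \<kappa>])
  then show "polar_base \<kappa> \<noteq> ({} :: 'a set set)" by blast
  fix B :: "'a set" assume "B \<in> polar_base \<kappa>"
  then obtain H F where B: "B = H \<inter> polar F" "zmod.subspace H" "index_less \<kappa> H"
    and F: "finite F" "F \<subseteq> Collect Modules.additive" by (rule polar_baseE)
  from F(2) have add: "\<phi> (x + y) = \<phi> x + \<phi> y" if "\<phi> \<in> F" for \<phi> x y
    using that by (auto simp: Modules.additive_def)
  have minus: "\<phi> (- x) = - \<phi> x" and zero: "\<phi> 0 = 0" if "\<phi> \<in> F" for \<phi> x
    using that F(2) Modules.additive.minus Modules.additive.zero by blast+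
  have "0 \<in> polar F" unfolding polar_def
  proof (intro CollectI ballI)
    show "\<phi> 0 \<in> circle_plus" if "\<phi> \<in> F" for \<phi> using zero[OF that] by simp
  qed
  then show "0 \<in> B" using B by (simp add: zmod.subspace_0)
  show "- x \<in> B" if "x \<in> B" for x
  proof -
    have "\<phi> (- x) \<in> circle_plus" if "\<phi> \<in> F" for \<phi>
      using minus[OF that, of x] \<open>x \<in> B\<close> that by (simp add: B(1) polar_def)
    then show ?thesis using that B by (simp add: polar_def zmod.subspace_neg)
  qed
  show "\<exists>D\<in>polar_base \<kappa>. D \<subseteq> B \<inter> C" if "C \<in> polar_base \<kappa>" for C
  proof -
    obtain K G where C: "C = K \<inter> polar G" "zmod.subspace K" "index_less \<kappa> K"
      "finite G" "G \<subseteq> Collect Modules.additive" using \<open>C \<in> polar_base \<kappa>\<close> by (rule polar_baseE)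
    have "(H \<inter> K) \<inter> polar (F \<union> G) \<in> polar_base \<kappa>"
      using B(2,3) F C(2-5) by (intro polar_baseI zmod.subspace_inter index_less_Int[OF \<kappa>]) simp_all
    moreover have "(H \<inter> K) \<inter> polar (F \<union> G) \<subseteq> B \<inter> C"
      unfolding B(1) C(1) polar_def by blast
    ultimately show ?thesis by blast
  qed
  \<comment> \<open>Adjoining the doubled homomorphisms confines every value to the arc of radius
    1/8, so sums of two values stay in the arc of radius 1/4.\<close>
  let ?G = "F \<union> (\<lambda>\<phi> x. zscale 2 (\<phi> x)) ` F"
  have "x + y \<in> B" if "x \<in> H \<inter> polar ?G" "y \<in> H \<inter> polar ?G" for x y
  proof -
    have "\<phi> (x + y) \<in> circle_plus" if \<phi>: "\<phi> \<in> F" for \<phi>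
    proof -
      have small: "\<exists>r. \<phi> z = to_circle r \<and> \<bar>r\<bar> \<le> 1 / 8" if "z \<in> polar ?G" for z
      proof -
        have "zscale (2 ^ k) (\<phi> z) \<in> circle_plus" if "k \<le> 1" for k :: nat
          using \<open>z \<in> polar ?G\<close> \<phi> that le_Suc_eq[of k 0] by (auto simp: polar_def)
        then obtain r where "\<phi> z = to_circle r" "\<bar>r\<bar> \<le> 1 / (4 * 2 ^ 1)"
          by (rule circle_plus_doubling[of 1 "\<phi> z"])
        then show ?thesis by auto
      qed
      obtain r where r: "\<phi> x = to_circle r" "\<bar>r\<bar> \<le> 1 / 8"
        using small \<open>x \<in> _\<close> by blast
      obtain s where s: "\<phi> y = to_circle s" "\<bar>s\<bar> \<le> 1 / 8"
        using small \<open>y \<in> _\<close> by blast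
      have "\<bar>r + s - of_int 0\<bar> \<le> 1 / 4" using r(2) s(2) unfolding of_int_0 by linarith
      then have "to_circle (r + s) \<in> circle_plus" unfolding to_circle_in_circle_plus by blast
      then show ?thesis by (simp add: add[OF \<phi>] r s to_circle_simps)
    qed
    moreover have "x + y \<in> H" using that B zmod.subspace_add by blast
    ultimately show ?thesis using B by (simp add: polar_def)
  qed
  moreover have "Modules.additive (\<lambda>x. zscale 2 (\<phi> x))" if "\<phi> \<in> F" for \<phi>
    using add[OF that] by (simp add: Modules.additive_def zmod.scale_right_distrib)
  then have "H \<inter> polar ?G \<in> polar_base \<kappa>"
    using B F by (intro polar_baseI) auto
  ultimately show "\<exists>C\<in>polar_base \<kappa>. \<forall>x\<in>C. \<forall>y\<in>C. x + y \<in> B" by blast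
qed

context
  fixes \<kappa> :: "'b rel"
  assumes \<kappa>: "Card_order \<kappa>" "natLeq \<le>o \<kappa>"
begin

interpretation group_base "polar_base \<kappa> :: 'a::ab_group_add set set"
  by (rule group_base_polar_base[OF \<kappa>])

text \<open>For a given homomorphism, the polar of its multiples by \<open>2 ^ k\<close> with
  \<open>k \<le> n\<close> is a basic neighbourhood witnessing continuity.\<close>

lemma characters_polar_base:
  "characters (base_topology (polar_base \<kappa> :: 'a::ab_group_add set set)) = {\<phi>. Modules.additive \<phi>}"
proof
  show "{\<phi>. Modules.additive \<phi>} \<subseteq> characters (base_topology (polar_base \<kappa> :: 'a set set))"
  proof
    fix \<phi> :: "'a \<Rightarrow> circle" assume "\<phi> \<in> {\<phi>. Modules.additive \<phi>}"
    then have \<phi>: "Modules.additive \<phi>" by simp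
    show "\<phi> \<in> characters (base_topology (polar_base \<kappa>))"
    proof (rule character_base_topology[OF \<phi>])
      fix n :: nat
      let ?F = "(\<lambda>k x. zscale (2 ^ k) (\<phi> x)) ` {..n}"
      have "?F \<subseteq> Collect Modules.additive"
        using \<phi> by (auto simp: Modules.additive_def zmod.scale_right_distrib)
      then have "UNIV \<inter> polar ?F \<in> polar_base \<kappa>"
        by (intro polar_baseI) (simp_all add: index_less_UNIV[OF \<kappa>])
      then show "\<exists>B\<in>polar_base \<kappa>. \<forall>b\<in>B. \<forall>k\<le>n. zscale (2 ^ k) (\<phi> b) \<in> circle_plus"
        by (rule bexI[rotated]) (simp add: polar_def)
    qed
  qed
qed (auto simp: characters_def)

text \<open>A point outside \<open>H \<inter> polar F\<close> is either in \<open>H\<close>, where a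
  member of \<open>F\<close> excludes it, or outside \<open>H\<close>, where a homomorphism
  vanishing on \<open>H\<close> does.\<close>

lemma locally_quasiconvex_polar_base:
  "locally_quasiconvex (base_topology (polar_base \<kappa> :: 'a::ab_group_add set set))"
proof (rule locally_quasiconvex_base_topology)
  fix B :: "'a set" assume "B \<in> polar_base \<kappa>"
  then obtain H F where B: "B = H \<inter> polar F" "zmod.subspace H" "F \<subseteq> Collect Modules.additive"
    by (rule polar_baseE)
  have "\<exists>\<phi>\<in>Collect Modules.additive. \<phi> ` B \<subseteq> circle_plus \<and> \<phi> g \<notin> circle_plus" if g: "g \<notin> B" for g
  proof (cases "g \<in> H")
    case True
    with g B show ?thesis by (auto simp: polar_def)
  next
    case False
    obtain \<phi> where "Modules.additive \<phi>" "\<And>h. h \<in> H \<Longrightarrow> \<phi> h = 0" "\<phi> g \<notin> circle_plus"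
      using character_separating_subgroup[OF B(2) False] by blast
    then show ?thesis using B(1) by (intro bexI[of _ \<phi>]) auto
  qed
  then show "quasiconvex (base_topology (polar_base \<kappa>)) B"
    by (simp add: quasiconvex_def characters_polar_base)
qed

end

section \<open>Quotients of prescribed cardinality\<close>

text \<open>The span lies in a countable union of stages, each the set of differences of the
  previous one, and no stage is larger than the infinite set \<open>A\<close>.\<close>

lemma card_of_span_ordLeq:
  fixes A :: "'a::ab_group_add set"
  assumes "infinite A"
  shows "|zmod.span A| \<le>o |A|"
proof -
  \<comment> \<open>Starting with 0 makes the stages increase, so any two elements of the union lie
    in a common stage.\<close>
  define D where "D = rec_nat (insert 0 A) (\<lambda>_ X. (\<lambda>(x, y). x - y) ` (X \<times> X))"
  have D0: "D 0 = insert 0 A" and D_Suc: "D (Suc n) = (\<lambda>(x, y). x - y) ` (D n \<times> D n)" for n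
    by (simp_all add: D_def)
  have zero: "0 \<in> D n" for n by (induction n) (force simp: D0 D_Suc)+
  have diff: "x - y \<in> D (Suc n)" if "x \<in> D n" "y \<in> D n" for x y n
    using that by (force simp: D_Suc)
  have "D n \<subseteq> D (Suc n)" for n
    using diff[OF _ zero] by force
  then have mono: "D m \<subseteq> D n" if "m \<le> n" for m n using that by (rule lift_Suc_mono_le)
  let ?X = "\<Union>n. D n"
  have diff': "x - y \<in> ?X" if xy: "x \<in> ?X" "y \<in> ?X" for x y
  proof -
    obtain m n where "x \<in> D m" "y \<in> D n" using xy by blast
    then have "x \<in> D (max m n)" "y \<in> D (max m n)" using mono max.cobounded1 max.cobounded2 by blast+
    then show ?thesis using diff by blast
  qed
  have zero': "0 \<in> ?X" using zero by blast
  have add': "x + y \<in> ?X" if "x \<in> ?X" "y \<in> ?X" for x y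
    using diff'[OF that(1) diff'[OF zero' that(2)]] by simp
  have "zmod.subspace ?X"
  proof (rule zmod.subspaceI)
    show "zscale c x \<in> ?X" if x: "x \<in> ?X" for c x
    proof (induction c rule: int_induct[where k = 0])
      case base
      show ?case using zero' by (simp only: zmod.scale_zero_left)
    next
      case (step1 i)
      then show ?case using add'[OF _ x] by (simp only: zscale_succ)
    next
      case (step2 i)
      then show ?case using diff'[OF _ x] by (simp only: zscale_pred)
    qed
  qed (rule zero', rule add')
  moreover have "A \<subseteq> ?X" using D0 by blast
  ultimately have sub: "zmod.span A \<subseteq> ?X" by (intro zmod.span_minimal)
  have "|D n| \<le>o |A|" for n
  proof (induction n)
    case 0
    have "|{0 :: 'a}| \<le>o |A|" using assms by (intro card_of_singl_ordLeq) auto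
    then show ?case
      unfolding D0 insert_is_Un[of 0 A] using assms
      by (intro card_of_Un_ordLeq_infinite_Field)
        (simp_all add: Field_card_of card_of_card_order_on card_of_refl ordIso_imp_ordLeq)
  next
    case (Suc n)
    have "|D n \<times> D n| \<le>o |A|"
      using Suc assms by (intro card_of_Times_ordLeq_infinite_Field) (simp_all add: Field_card_of card_of_card_order_on)
    then show ?case unfolding D_Suc by (rule ordLeq_transitive[OF card_of_image])
  qed
  moreover have "|UNIV :: nat set| \<le>o |A|"
    using assms infinite_iff_card_of_nat by blast
  ultimately have "|?X| \<le>o |A|"
    using assms by (intro card_of_UNION_ordLeq_infinite) simp_all
  then show ?thesis by (rule ordLeq_transitive[OF card_of_mono1[OF sub]])
qed

text \<open>
  If \<open>N\<close> is maximal with \<open>N \<inter> S = 0\<close>, then \<open>G / N\<close> is an essential extension of the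
  image of \<open>S\<close>. So its elements of prime order lie in that image, every element has a nonzero
  multiple in it, and dividing by one prime at a time shows that \<open>G / N\<close> is no larger than \<open>S\<close>.
\<close>

lemma exists_subgroup_of_index:
  fixes \<kappa> :: "'a::ab_group_add rel"
  assumes "index_cardinal \<kappa>"
  obtains S N :: "'a set" and T :: "'a set"
  where "zmod.subspace S" "zmod.subspace N" "N \<inter> S \<subseteq> {0}" "\<kappa> \<le>o |S|"
    and "|T| \<le>o \<kappa>" "\<And>x. \<exists>t\<in>T. x - t \<in> N"
proof -
  have \<kappa>: "Card_order \<kappa>" "natLeq \<le>o \<kappa>" using assms by (simp_all add: index_cardinal_def)
  have inf: "infinite (Field \<kappa>)" by (rule infinite_Field[OF \<kappa>])
  \<comment> \<open>As a relation on the group, \<open>\<kappa>\<close> has a field that is already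
    a subset of size \<open>\<kappa>\<close>; generating a subgroup does not enlarge it.\<close>
  define S where "S = zmod.span (Field \<kappa>)"
  have S: "zmod.subspace S" by (simp add: S_def)
  have iso: "|Field \<kappa>| =o \<kappa>" by (rule card_of_Field_ordIso[OF \<kappa>(1)])
  have S_le: "|S| \<le>o \<kappa>" unfolding S_def by (rule ordLeq_ordIso_trans[OF card_of_span_ordLeq[OF inf] iso])
  have S_ge: "\<kappa> \<le>o |S|"
    unfolding S_def
    by (rule ordIso_ordLeq_trans[OF ordIso_symmetric[OF iso] card_of_mono1[OF zmod.span_superset]])
  have "{0} \<inter> S \<subseteq> {0}" by blast
  then obtain N where N: "zmod.subspace N" and "{0} \<subseteq> N" and NS: "N \<inter> S \<subseteq> {0}"
    and max: "\<And>x. x \<notin> N \<Longrightarrow> \<exists>r\<in>N. \<exists>k. r + zscale k x \<in> S - {0}"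
    by (rule maximal_subgroup_avoiding[OF zmod.subspace_single_0]) (rule that)
  \<comment> \<open>\<open>cov X\<close>: at most \<open>\<kappa>\<close> cosets of \<open>N\<close>
    cover \<open>X\<close>.\<close>
  define cov where "cov X \<longleftrightarrow> (\<exists>T. |T| \<le>o \<kappa> \<and> (\<forall>x\<in>X. \<exists>t\<in>T. x - t \<in> N))" for X
  have S0: "0 \<in> S" by (rule zmod.subspace_0[OF S])
  \<comment> \<open>Elements of order \<open>p\<close> modulo \<open>N\<close> come from
    \<open>S\<close>: maximality puts a multiple of \<open>y\<close> by some \<open>k\<close> into
    \<open>S + N\<close>, \<open>p\<close> cannot divide \<open>k\<close>, and Bezout recovers
    \<open>y\<close>.\<close>
  have torsion: "\<exists>s\<in>S. y - s \<in> N" if p: "prime p" and y: "zscale (int p) y \<in> N" for p y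
  proof (cases "y \<in> N")
    case True
    then show ?thesis using S0 by (intro bexI[of _ 0]) simp_all
  next
    case False
    then obtain r k where r: "r \<in> N" "r + zscale k y \<in> S" "r + zscale k y \<noteq> 0" using max by blast
    have "\<not> int p dvd k"
    proof
      assume "int p dvd k"
      then obtain c where "k = c * int p" by (metis dvdE mult.commute)
      then have "zscale k y \<in> N" using zmod.subspace_scale[OF N y, of c] by simp
      then have "r + zscale k y \<in> N" by (rule zmod.subspace_add[OF N r(1)])
      with r NS show False by blast
    qed
    then have "coprime (int p) k" using p by (intro prime_imp_coprime) simp_all
    then obtain b a where ab: "b * int p + a * k = 1"
      using bezout_int[of "int p" k] by (metis coprime_imp_gcd_eq_1)
    have "y = zscale (b * int p + a * k) y" by (simp add: ab)
    also have "\<dots> = zscale b (zscale (int p) y) + zscale a (zscale k y)"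
      by (simp add: zmod.scale_left_distrib)
    finally have "y - zscale a (r + zscale k y) = zscale b (zscale (int p) y) - zscale a r"
      by (simp add: zmod.scale_right_distrib algebra_simps)
    moreover have "zscale b (zscale (int p) y) - zscale a r \<in> N"
      by (intro zmod.subspace_diff[OF N] zmod.subspace_scale[OF N] y r)
    ultimately have "y - zscale a (r + zscale k y) \<in> N" by simp
    moreover have "zscale a (r + zscale k y) \<in> S" by (rule zmod.subspace_scale[OF S r(2)])
    ultimately show ?thesis by blast
  qed
  \<comment> \<open>Modulo \<open>N\<close>, two solutions of the same division by \<open>p\<close>
    differ by \<open>p\<close>-torsion, hence by an element of \<open>S\<close>; one chosen solution
    \<open>u t\<close> per representative \<open>t\<close> therefore suffices.\<close>
  have step: "cov {x. zscale (int p) x \<in> X}" if p: "prime p" and X: "cov X" for p X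
  proof -
    obtain T where T: "|T| \<le>o \<kappa>" "\<forall>x\<in>X. \<exists>t\<in>T. x - t \<in> N" using X by (auto simp: cov_def)
    define u where "u t = (SOME x. zscale (int p) x - t \<in> N)" for t
    let ?T = "(\<lambda>(t, s). u t + s) ` (T \<times> S)"
    have "\<exists>v\<in>?T. x - v \<in> N" if x: "zscale (int p) x \<in> X" for x
    proof -
      obtain t where t: "t \<in> T" "zscale (int p) x - t \<in> N" using T(2) x by blast
      then have ut: "zscale (int p) (u t) - t \<in> N" unfolding u_def by (intro someI)
      have "zscale (int p) (x - u t) = (zscale (int p) x - t) - (zscale (int p) (u t) - t)"
        by (simp add: zmod.scale_right_diff_distrib)
      then have "zscale (int p) (x - u t) \<in> N" using zmod.subspace_diff[OF N t(2) ut] by simp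
      then obtain s where "s \<in> S" "x - u t - s \<in> N" using torsion[OF p] by blast
      then show ?thesis using t(1) by (intro bexI[of _ "u t + s"]) (auto simp: diff_diff_add)
    qed
    moreover have "|T \<times> S| \<le>o \<kappa>" by (rule card_of_Times_ordLeq_infinite_Field[OF inf T(1) S_le \<kappa>(1)])
    then have "|?T| \<le>o \<kappa>" by (rule ordLeq_transitive[OF card_of_image])
    ultimately show ?thesis unfolding cov_def by (intro exI[of _ ?T]) simp
  qed
  define E where "E n = {x. \<exists>s\<in>S. zscale (int n) x - s \<in> N}" for n
  \<comment> \<open>Induction over prime factors, since \<open>E (p * n)\<close> is the preimage of
    \<open>E n\<close> under multiplication by \<open>p\<close>. Zero is excluded because
    \<open>E 0\<close> is the whole group.\<close>
  have cov_E: "n > 0 \<longrightarrow> cov (E n)" for n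
  proof (induction n rule: prime_divisors_induct)
    case (unit n)
    have "cov (E 1)" using S_le unfolding cov_def E_def by (intro exI[of _ S]) simp
    with unit show ?case by simp
  next
    case (factor p n)
    show ?case
    proof
      assume "p * n > 0"
      then have "cov {x. zscale (int p) x \<in> E n}" using factor by (intro step) simp_all
      moreover have "{x. zscale (int p) x \<in> E n} = E (p * n)"
        by (simp add: E_def mult.commute)
      ultimately show "cov (E (p * n))" by simp
    qed
  qed simp
  \<comment> \<open>Essentiality: outside \<open>N\<close>, maximality yields a nonzero integer
    carrying \<open>x\<close> into \<open>S + N\<close>, and \<open>sgn\<close> makes it
    positive.\<close>
  have all: "\<exists>n. x \<in> E (Suc n)" for x
  proof (cases "x \<in> N")
    case True
    then have "x \<in> E (Suc 0)" using S0 by (auto simp: E_def intro!: bexI[of _ 0])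
    then show ?thesis by blast
  next
    case False
    then obtain r k where r: "r \<in> N" "r + zscale k x \<in> S" "r + zscale k x \<noteq> 0" using max by blast
    then have "k \<noteq> 0" using NS by auto
    then obtain n where n: "\<bar>k\<bar> = int (Suc n)" by (metis not0_implies_Suc abs_eq_0 int_eq_iff abs_ge_zero nat_0_le zero_le_imp_eq_int of_nat_0)
    have "zscale \<bar>k\<bar> x - zscale (sgn k) (r + zscale k x) = - zscale (sgn k) r"
      by (simp add: zmod.scale_right_distrib abs_sgn mult.commute)
    then have "zscale (int (Suc n)) x - zscale (sgn k) (r + zscale k x) \<in> N"
      using zmod.subspace_neg[OF N zmod.subspace_scale[OF N r(1)]] by (simp only: n)
    then show ?thesis using zmod.subspace_scale[OF S r(2)] unfolding E_def by blast
  qed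
  have "\<forall>n. \<exists>T. |T| \<le>o \<kappa> \<and> (\<forall>x\<in>E (Suc n). \<exists>t\<in>T. x - t \<in> N)"
    using cov_E by (simp add: cov_def)
  then obtain T where T: "\<And>n. |T n| \<le>o \<kappa>" "\<And>n x. x \<in> E (Suc n) \<Longrightarrow> \<exists>t\<in>T n. x - t \<in> N"
    by metis
  have "|UNIV :: nat set| \<le>o \<kappa>"
    by (rule ordIso_ordLeq_trans[OF card_of_nat \<kappa>(2)])
  then have "|\<Union>n. T n| \<le>o \<kappa>"
    using T(1) inf \<kappa>(1) by (intro card_of_UNION_ordLeq_infinite_Field) simp_all
  moreover have "\<exists>t\<in>(\<Union>n. T n). x - t \<in> N" for x
    using all[of x] T(2) by blast
  ultimately show thesis by (rule that[OF S N NS S_ge])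
qed

section \<open>Strict monotonicity\<close>

text \<open>
  Characters take values in one of four quarter arcs, so the values of finitely many of them
  split the group into finitely many classes whose differences lie in the polar.
\<close>

lemma subgroup_card_less:
  fixes S N :: "'a::ab_group_add set"
  assumes \<kappa>: "Card_order \<kappa>" "natLeq \<le>o \<kappa>" and S: "zmod.subspace S" "N \<inter> S \<subseteq> {0}"
    and B: "B \<in> polar_base \<kappa>" "B \<subseteq> N"
  shows "|S| <o \<kappa>"
proof -
  obtain H F where HF: "B = H \<inter> polar F" "zmod.subspace H" "index_less \<kappa> H"
    "finite F" "F \<subseteq> Collect Modules.additive" using B(1) by (rule polar_baseE)
  obtain T where T: "|T| <o \<kappa>" "\<And>x. \<exists>t\<in>T. x - t \<in> H" using HF(3) by (auto simp: index_less_def)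
  obtain t where t: "\<And>x. t x \<in> T" "\<And>x. x - t x \<in> H" using T(2) by metis
  \<comment> \<open>\<open>q x\<close> records, for each member of \<open>F\<close>, which of the
    four quarter arcs contains its value at \<open>x\<close>.\<close>
  define q where "q x = (\<lambda>\<phi>\<in>F. \<lfloor>4 * frac (rep_circle (\<phi> x))\<rfloor>)" for x
  have q: "q x \<in> F \<rightarrow>\<^sub>E {0..3}" for x
  proof -
    have "0 \<le> \<lfloor>4 * frac r\<rfloor> \<and> \<lfloor>4 * frac r\<rfloor> \<le> 3" for r :: real
      using frac_ge_0[of r] frac_lt_1[of r] by linarith
    then show ?thesis by (simp add: q_def)
  qed
  have polar: "x - y \<in> polar F" if xy: "q x = q y" for x y
    unfolding polar_def
  proof (intro CollectI ballI)
    fix \<phi> assume \<phi>: "\<phi> \<in> F"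
    let ?r = "rep_circle (\<phi> x)" and ?s = "rep_circle (\<phi> y)"
    have "\<lfloor>4 * frac ?r\<rfloor> = \<lfloor>4 * frac ?s\<rfloor>" using fun_cong[OF xy, of \<phi>] \<phi> by (simp add: q_def)
    then have "\<bar>frac ?r - frac ?s\<bar> \<le> 1 / 4" by linarith
    then have "\<bar>?r - ?s - of_int (\<lfloor>?r\<rfloor> - \<lfloor>?s\<rfloor>)\<bar> \<le> 1 / 4" by (simp add: frac_def algebra_simps)
    then have "to_circle (?r - ?s) \<in> circle_plus" unfolding to_circle_in_circle_plus by blast
    moreover have "\<phi> (x - y) = \<phi> x - \<phi> y"
      using \<phi> HF(5) Modules.additive.diff by blast
    ultimately show "\<phi> (x - y) \<in> circle_plus" by (simp add: to_circle_simps)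
  qed
  \<comment> \<open>Equal data put the difference of two elements of \<open>S\<close> into
    \<open>H \<inter> polar F\<close>, hence into \<open>N \<inter> S\<close>, where only 0 is
    left.\<close>
  have "inj_on (\<lambda>x. (t x, q x)) S"
  proof (rule inj_onI)
    fix x y assume xy: "x \<in> S" "y \<in> S" "(t x, q x) = (t y, q y)"
    have "(x - t x) - (y - t y) \<in> H" by (rule zmod.subspace_diff[OF HF(2) t(2) t(2)])
    then have "x - y \<in> H" using xy(3) by simp
    moreover have "x - y \<in> polar F" using polar xy(3) by simp
    ultimately have "x - y \<in> N" using B(2) HF(1) by blast
    moreover have "x - y \<in> S" by (rule zmod.subspace_diff[OF S(1) xy(1,2)])
    ultimately have "x - y = 0" using S(2) by blast
    then show "x = y" by simp
  qed
  moreover have "(\<lambda>x. (t x, q x)) ` S \<subseteq> T \<times> (F \<rightarrow>\<^sub>E {0..3})" using t q by blast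
  ultimately have "|S| \<le>o |T \<times> (F \<rightarrow>\<^sub>E {0..3::int})|" using card_of_ordLeq by blast
  moreover have "|F \<rightarrow>\<^sub>E {0..3::int}| <o \<kappa>"
    using HF(4) by (intro finite_ordLess[OF \<kappa>] finite_PiE) simp_all
  then have "|T \<times> (F \<rightarrow>\<^sub>E {0..3::int})| <o \<kappa>" by (rule Times_ordLess[OF \<kappa> T(1)])
  ultimately show ?thesis by (rule ordLeq_ordLess_trans)
qed

lemma index_less_mono:
  assumes "index_less \<kappa> H" "\<kappa> \<le>o \<kappa>'"
  shows "index_less \<kappa>' H"
  using assms ordLess_ordLeq_trans unfolding index_less_def by blast

lemma polar_base_mono:
  assumes "\<kappa> \<le>o \<kappa>'"
  shows "polar_base \<kappa> \<subseteq> polar_base \<kappa>'"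
  unfolding polar_base_def using index_less_mono[OF _ assms] by blast

lemma base_topology_polar_base_strict_mono:
  fixes \<kappa> \<kappa>' :: "'a::ab_group_add rel"
  assumes \<kappa>: "index_cardinal \<kappa>" and \<kappa>': "index_cardinal \<kappa>'" and less: "\<kappa> <o \<kappa>'"
  shows "Collect (openin (base_topology (polar_base \<kappa> :: 'a set set)))
    \<subset> Collect (openin (base_topology (polar_base \<kappa>')))"
proof -
  have card: "Card_order \<kappa>" "natLeq \<le>o \<kappa>" and card': "Card_order \<kappa>'" "natLeq \<le>o \<kappa>'"
    using \<kappa> \<kappa>' by (simp_all add: index_cardinal_def)
  interpret X: group_base "polar_base \<kappa> :: 'a set set" by (rule group_base_polar_base[OF card])
  interpret Y: group_base "polar_base \<kappa>' :: 'a set set" by (rule group_base_polar_base[OF card'])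
  have sub: "polar_base \<kappa> \<subseteq> (polar_base \<kappa>' :: 'a set set)"
    by (rule polar_base_mono[OF ordLess_imp_ordLeq[OF less]])
  \<comment> \<open>\<open>T\<close> bounds the index of \<open>N\<close> from above, which makes
    \<open>N\<close> open for \<open>\<kappa>'\<close>; the size of \<open>S\<close>, which embeds
    in the quotient by \<open>N\<close>, bounds it from below and rules out openness for
    \<open>\<kappa>\<close>.\<close>
  obtain S N T :: "'a set" where S: "zmod.subspace S" and N: "zmod.subspace N" "N \<inter> S \<subseteq> {0}"
    and ge: "\<kappa> \<le>o |S|" and T: "|T| \<le>o \<kappa>" "\<And>x. \<exists>t\<in>T. x - t \<in> N"
    by (rule exists_subgroup_of_index[OF \<kappa>]) blast
  have "index_less \<kappa>' N"
    unfolding index_less_def using ordLeq_ordLess_trans[OF T(1) less] T(2) by (intro exI[of _ T]) simp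
  then have "N \<inter> polar {} \<in> polar_base \<kappa>'" by (intro polar_baseI N) simp_all
  then have "openin (base_topology (polar_base \<kappa>')) N"
    unfolding Y.openin_base_topology using zmod.subspace_add[OF N(1)] by (intro ballI bexI) auto
  moreover have "\<not> openin (base_topology (polar_base \<kappa>)) N"
  proof
    assume "openin (base_topology (polar_base \<kappa>)) N"
    then obtain B where "B \<in> polar_base \<kappa>" "\<forall>b\<in>B. 0 + b \<in> N"
      using zmod.subspace_0[OF N(1)] unfolding X.openin_base_topology by blast
    then have "|S| <o \<kappa>" by (intro subgroup_card_less[OF card S N(2)]) auto
    with ge show False using not_ordLess_ordLeq by blast
  qed
  moreover have "openin (base_topology (polar_base \<kappa>')) U"
    if "openin (base_topology (polar_base \<kappa>)) U" for U :: "'a set"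
    using that sub unfolding X.openin_base_topology Y.openin_base_topology by blast
  ultimately show ?thesis by blast
qed

theorem corollary5p8:
  assumes "uncountable (UNIV :: 'a::ab_group_add set)"
  shows "\<exists>\<tau> :: 'a::ab_group_add rel \<Rightarrow> 'a topology.
    (\<forall>\<kappa> \<kappa>'. index_cardinal \<kappa> \<and> index_cardinal \<kappa>' \<and> \<kappa> =o \<kappa>' \<longrightarrow> \<tau> \<kappa> = \<tau> \<kappa>') \<and>
    (\<forall>\<kappa>. index_cardinal \<kappa> \<longrightarrow>
       group_topology (\<tau> \<kappa>) \<and> locally_quasiconvex (\<tau> \<kappa>) \<and>
       characters (\<tau> \<kappa>) = {\<phi>. Modules.additive \<phi>}) \<and>
    (\<forall>\<kappa> \<kappa>'. index_cardinal \<kappa> \<and> index_cardinal \<kappa>' \<and> \<kappa> <o \<kappa>' \<longrightarrow>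
       Collect (openin (\<tau> \<kappa>)) \<subset> Collect (openin (\<tau> \<kappa>')))"
proof (intro exI[of _ "\<lambda>\<kappa>. base_topology (polar_base \<kappa>)"] conjI allI impI)
  fix \<kappa> \<kappa>' :: "'a rel"
  assume "index_cardinal \<kappa> \<and> index_cardinal \<kappa>' \<and> \<kappa> =o \<kappa>'"
  \<comment> \<open>Monotonicity in both directions shows that the base depends only on the
    cardinal, not on the chosen well-order.\<close>
  then have "\<kappa> \<le>o \<kappa>'" "\<kappa>' \<le>o \<kappa>" by (simp_all add: ordIso_iff_ordLeq)
  then have "polar_base \<kappa> = (polar_base \<kappa>' :: 'a set set)"
    by (intro equalityI polar_base_mono)
  then show "base_topology (polar_base \<kappa>) = (base_topology (polar_base \<kappa>') :: 'a topology)"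
    by simp
next
  fix \<kappa> :: "'a rel"
  assume "index_cardinal \<kappa>"
  then have \<kappa>: "Card_order \<kappa>" "natLeq \<le>o \<kappa>" by (simp_all add: index_cardinal_def)
  show "group_topology (base_topology (polar_base \<kappa> :: 'a set set))"
    by (rule group_base.group_topology_base_topology[OF group_base_polar_base[OF \<kappa>]])
  show "locally_quasiconvex (base_topology (polar_base \<kappa> :: 'a set set))"
    by (rule locally_quasiconvex_polar_base[OF \<kappa>])
  show "characters (base_topology (polar_base \<kappa> :: 'a set set)) = {\<phi>. Modules.additive \<phi>}"
    by (rule characters_polar_base[OF \<kappa>])
next
  fix \<kappa> \<kappa>' :: "'a rel"
  assume "index_cardinal \<kappa> \<and> index_cardinal \<kappa>' \<and> \<kappa> <o \<kappa>'"
  then show "Collect (openin (base_topology (polar_base \<kappa> :: 'a set set)))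
      \<subset> Collect (openin (base_topology (polar_base \<kappa>')))"
    using base_topology_polar_base_strict_mono by blast
qed

end
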